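(* Let $H>0$, $0<\delta<1$ and $\varepsilon>0$. Let $v_{\widetilde{N}}$ be the point returned by $\widetilde{N}$ iterations of the Accelerated Meta-algorithm started at $x_0\in\mathbb{R}^n$ in which each auxiliary problem is solved by running $N_\delta$ iterations of the coordinate descent method. If $$\widetilde{N}\geq\left\lceil\frac{4\sqrt{15}}{5}\sqrt{\frac{H\|x_0-x_*\|_2^2}{\varepsilon}}\,\right\rceil,\qquad N_\delta\geq\left\lceil\frac{Z}{H}\ln\left\{\frac{\widetilde{N}}{\delta}\left(1+\frac{L}{H}\right)\left(3+\frac{2L}{H}\right)^2\right\}\right\rceil,$$ where $Z=\sum_{i=1}^n(H+L_i)$, then $$\Pr\left(f(v_{\widetilde{N}})-f(x_* )<\varepsilon\right)\geq 1-\delta .$$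
   Context: Standing assumptions: $f:\mathbb{R}^n\to\mathbb{R}$ is differentiable and convex, with a minimizer $x_*$; $\nabla f$ is $L$-Lipschitz continuous with respect to $\|\cdot\|_2$; for each $i\in\{1,\dots,n\}$ there is a constant $L_i$ such that $|\nabla_i f(x+ue_i)-\nabla_i f(x)|\leq L_i|u|$ for all $x\in\mathbb{R}^n$, $u\in\mathbb{R}$, where $e_i$ is the $i$-th unit basis vector. Accelerated Meta-algorithm (inputs $H>0$, $x_0\in\mathbb{R}^n$): set $\lambda=\frac{1}{2H}$, $A_0=0$, $v_0=x_0$. For $k=0,\dots,\widetilde{N}-1$: $a_{k+1}=\frac{\lambda+\sqrt{\lambda^2+4\lambda A_k}}{2}$; $A_{k+1}=A_k+a_{k+1}$; $\widetilde{x}_k=\frac{A_kv_k+a_{k+1}x_k}{A_{k+1}}$; let $v_{k+1}$ be the approximate solution, returned by an inner method, of the auxiliary problem $\min_{y\in\mathbb{R}^n}F_k(y)$, $F_k(y)=f(y)+\frac{H}{2}\|y-\widetilde{x}_k\|_2^2$; set $x_{k+1}=x_k-a_{k+1}\nabla f(v_{k+1})$. Return $v_{\widetilde{N}}$. Inner method (coordinate descent applied to $F=F_k$, with $N$ iterations, started at $y_0=\widetilde{x}_k$): with $Z=\sum_{i=1}^n(H+L_i)$ and $p_i=(H+L_i)/Z$, for $j=0,\dots,N-1$ draw (independently) an index $i$ with probability $p_i$ and set $y_{j+1}=y_j-\frac{1}{H+L_i}\nabla_iF(y_j)\,e_i$. Return $y_N$. The probability is over all random index choices. *)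

theory Defs
  imports "HOL-Probability.Probability"
begin

definition grad :: "('a::real_inner \<Rightarrow> real) \<Rightarrow> 'a \<Rightarrow> 'a" where
  "grad f x = (THE D. GDERIV f x :> D)"

lemma GDERIV_grad:
  fixes f :: "'a::euclidean_space \<Rightarrow> real"
  assumes "f differentiable (at x)"
  shows "GDERIV f x :> grad f x"
proof -
  obtain f' where f': "(f has_derivative f') (at x)"
    using assms by (auto simp: differentiable_def)
  let ?D = "\<Sum>b\<in>Basis. f' b *\<^sub>R b"
  have lin: "linear f'"
    using f' has_derivative_linear by blast
  have "f' h = h \<bullet> ?D" for h
  proof -
    have "f' h = f' (\<Sum>b\<in>Basis. (h \<bullet> b) *\<^sub>R b)"
      by (simp add: euclidean_representation)
    also have "\<dots> = (\<Sum>b\<in>Basis. (h \<bullet> b) * f' b)"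
      by (simp add: linear_sum[OF lin] linear_scale[OF lin])
    finally show ?thesis
      by (simp add: inner_sum_right mult.commute)
  qed
  then have eq: "f' = (\<lambda>h. h \<bullet> ?D)"
    by blast
  have D: "GDERIV f x :> ?D"
    using f' unfolding gderiv_def by (subst (asm) eq)
  moreover have "D1 = ?D" if "GDERIV f x :> D1" for D1
  proof -
    have "(\<lambda>h. h \<bullet> D1) = (\<lambda>h. h \<bullet> ?D)"
      using has_derivative_unique that D unfolding gderiv_def by blast
    then have "\<And>h. h \<bullet> D1 = h \<bullet> ?D"
      by meson
    then show ?thesis
      using vector_eq_ldot by blast
  qed
  ultimately show ?thesis
    unfolding grad_def by (rule theI)
qed

(* embed_pmf is meaningful only for nonnegative weights summing to 1; see pmf_index_pmf. *)
definition index_pmf :: "real \<Rightarrow> ('n::finite \<Rightarrow> real) \<Rightarrow> 'n pmf" where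
  "index_pmf H Lc = embed_pmf (\<lambda>i. (H + Lc i) / (\<Sum>j\<in>UNIV. H + Lc j))"

lemma pmf_index_pmf:
  fixes Lc :: "'n::finite \<Rightarrow> real"
  assumes "\<And>i. 0 < H + Lc i"
  shows "pmf (index_pmf H Lc) i = (H + Lc i) / (\<Sum>j\<in>UNIV. H + Lc j)"
proof -
  let ?Z = "\<Sum>j\<in>UNIV. H + Lc j"
  have Z: "0 < ?Z"
    using assms by (simp add: sum_pos)
  have nn: "0 \<le> (H + Lc i) / ?Z" for i
    by (rule divide_nonneg_pos[OF less_imp_le[OF assms] Z])
  have "(\<Sum>i\<in>UNIV. (H + Lc i) / ?Z) = 1"
    using Z by (subst sum_divide_distrib[symmetric]) simp
  then have "(\<integral>\<^sup>+ i. ennreal ((H + Lc i) / ?Z) \<partial>count_space UNIV) = 1"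
    using nn by (simp add: nn_integral_count_space_finite sum_ennreal)
  then show ?thesis
    unfolding index_pmf_def using nn by (subst pmf_embed_pmf) auto
qed

primrec coord_descent ::
  "real \<Rightarrow> ('n::finite \<Rightarrow> real) \<Rightarrow> nat \<Rightarrow> (real^'n \<Rightarrow> real) \<Rightarrow> real^'n \<Rightarrow> (real^'n) pmf" where
  "coord_descent H Lc 0 F y0 = return_pmf y0"
| "coord_descent H Lc (Suc j) F y0 = do {
     y \<leftarrow> coord_descent H Lc j F y0;
     i \<leftarrow> index_pmf H Lc;
     return_pmf (y - (1 / (H + Lc i) * (grad F y $ i)) *\<^sub>R axis i 1)
   }"

(* meta_a H A is the step a_{k+1} when A_k = A; here lam = 1/(2H). *)
definition meta_a :: "real \<Rightarrow> real \<Rightarrow> real" where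
  "meta_a H A = (let lam = 1 / (2 * H) in (lam + sqrt (lam\<^sup>2 + 4 * lam * A)) / 2)"

primrec meta_A :: "real \<Rightarrow> nat \<Rightarrow> real" where
  "meta_A H 0 = 0"
| "meta_A H (Suc k) = meta_A H k + meta_a H (meta_A H k)"

(* The law of the pair (x_k, v_k). The argument solve F y0 is the law of the point returned by
   the inner method for the objective F and the starting point y0; each call uses fresh
   randomness. *)
primrec accel_meta ::
  "(('a::real_inner \<Rightarrow> real) \<Rightarrow> 'a \<Rightarrow> 'a pmf) \<Rightarrow> ('a \<Rightarrow> real) \<Rightarrow> real \<Rightarrow> 'a \<Rightarrow> nat \<Rightarrow> ('a \<times> 'a) pmf" where
  "accel_meta solve f H x0 0 = return_pmf (x0, x0)"
| "accel_meta solve f H x0 (Suc k) = do {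
     (x, v) \<leftarrow> accel_meta solve f H x0 k;
     let a = meta_a H (meta_A H k);
     let xt = (1 / meta_A H (Suc k)) *\<^sub>R (meta_A H k *\<^sub>R v + a *\<^sub>R x);
     v' \<leftarrow> solve (\<lambda>y. f y + H / 2 * (norm (y - xt))\<^sup>2) xt;
     return_pmf (x - a *\<^sub>R grad f v', v')
   }"

definition accel_meta_output ::
  "(('a::real_inner \<Rightarrow> real) \<Rightarrow> 'a \<Rightarrow> 'a pmf) \<Rightarrow> ('a \<Rightarrow> real) \<Rightarrow> real \<Rightarrow> 'a \<Rightarrow> nat \<Rightarrow> 'a pmf" where
  "accel_meta_output solve f H x0 N = map_pmf snd (accel_meta solve f H x0 N)"

end

theory Submission imports Defs begin

text \<open>
  The potential \<open>A\<^sub>k (f v\<^sub>k - f x\<^sub>*) + \<parallel>x\<^sub>k - x\<^sub>*\<parallel>\<^sup>2 / 2\<close> does not increase in an outer step whose inner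
  solution satisfies \<open>\<parallel>\<nabla>F v\<parallel> \<le> H/2 \<parallel>v - c\<parallel>\<close>, where \<open>c\<close> is the centre of the proximal term; since
  \<open>A\<^sub>k \<ge> k\<^sup>2 / (8 H)\<close>, this gives \<open>f v\<^sub>k - f x\<^sub>* \<le> 4 H \<parallel>x\<^sub>0 - x\<^sub>*\<parallel>\<^sup>2 / k\<^sup>2\<close>.
  If \<open>y\<^sub>*\<close> minimizes \<open>F\<close>, the required inequality follows from \<open>\<parallel>v - y\<^sub>*\<parallel> \<le> \<parallel>c - y\<^sub>*\<parallel> / (3 + 2 L / H)\<close>
  and hence, by strong convexity, from \<open>F v - F y\<^sub>* \<le> H/2 (\<parallel>c - y\<^sub>*\<parallel> / (3 + 2 L / H))\<^sup>2\<close>. Each step of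
  coordinate descent multiplies the expectation of \<open>F - F y\<^sub>*\<close> by at most \<open>1 - H / Z \<le> exp (- H / Z)\<close>,
  starting from at most \<open>(L + H)/2 \<parallel>c - y\<^sub>*\<parallel>\<^sup>2\<close>, so Markov's inequality bounds the failure probability
  of one inner run by \<open>\<delta> / N\<close>, and the union bound over the outer iterations concludes.
\<close>

subsection \<open>Gradients and one-dimensional restrictions\<close>

lemma grad_eqI:
  fixes f :: "'a::euclidean_space \<Rightarrow> real"
  assumes "GDERIV f x :> D"
  shows "grad f x = D"
proof -
  have "GDERIV f x :> grad f x"
    using assms by (intro GDERIV_grad) (auto simp: gderiv_def differentiable_def)
  then have "(\<lambda>h. h \<bullet> grad f x) = (\<lambda>h. h \<bullet> D)"
    using assms has_derivative_unique unfolding gderiv_def by blast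
  then show ?thesis
    by (meson vector_eq_ldot)
qed

lemma GDERIV_along_line:
  assumes "GDERIV f (x + t *\<^sub>R d) :> D"
  shows "((\<lambda>s. f (x + s *\<^sub>R d)) has_real_derivative D \<bullet> d) (at t)"
proof -
  have "((\<lambda>s. x + s *\<^sub>R d) has_derivative (\<lambda>h. h *\<^sub>R d)) (at t)"
    by (auto intro!: derivative_eq_intros)
  from has_derivative_compose[OF this assms[unfolded gderiv_def]]
  have "((\<lambda>s. f (x + s *\<^sub>R d)) has_derivative (\<lambda>h. h *\<^sub>R d \<bullet> D)) (at t)" .
  moreover have "(\<lambda>h. h *\<^sub>R d \<bullet> D) = (*) (D \<bullet> d)"
    by (simp add: fun_eq_iff inner_commute[of d])
  ultimately show ?thesis
    by (simp add: has_field_derivative_def)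
qed

text \<open>Subtracting the quadratic leaves a function that increases up to 0 and decreases after
  it. Serves both coordinate directions and the segment issuing from a minimizer.\<close>

lemma quadratic_upper_bound:
  fixes \<phi> \<phi>' :: "real \<Rightarrow> real"
  assumes deriv: "\<And>t. (\<phi> has_real_derivative \<phi>' t) (at t)"
    and bound: "\<And>t. \<bar>\<phi>' t - \<phi>' 0\<bar> \<le> M * \<bar>t\<bar>"
  shows "\<phi> t \<le> \<phi> 0 + \<phi>' 0 * t + M / 2 * t\<^sup>2"
proof -
  define \<psi> where "\<psi> = (\<lambda>t. \<phi> t - \<phi>' 0 * t - M / 2 * t\<^sup>2)"
  have d: "(\<psi> has_real_derivative \<phi>' t - \<phi>' 0 - M * t) (at t)" for t
    unfolding \<psi>_def by (auto intro!: derivative_eq_intros deriv)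
  have "\<psi> t \<le> \<psi> 0"
  proof (cases "t \<ge> 0")
    case True
    then show ?thesis
    proof (rule DERIV_nonpos_imp_nonincreasing)
      show "\<exists>y. (\<psi> has_real_derivative y) (at s) \<and> y \<le> 0" if "0 \<le> s" "s \<le> t" for s
        using d[of s] bound[of s] that by (intro exI[of _ "\<phi>' s - \<phi>' 0 - M * s"]) auto
    qed
  next
    case False
    then have "t \<le> 0" by simp
    then show ?thesis
    proof (rule DERIV_nonneg_imp_nondecreasing)
      show "\<exists>y. (\<psi> has_real_derivative y) (at s) \<and> 0 \<le> y" if "t \<le> s" "s \<le> 0" for s
        using d[of s] bound[of s] that by (intro exI[of _ "\<phi>' s - \<phi>' 0 - M * s"]) auto
    qed
  qed
  then show ?thesis
    by (simp add: \<psi>_def)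
qed

text \<open>Restriction to the line through \<open>x\<close> and \<open>y\<close> reduces this to
  the one-dimensional tangent inequality.\<close>

lemma convex_above_tangent_plane:
  fixes f :: "'a::real_inner \<Rightarrow> real"
  assumes conv: "convex_on UNIV f" and D: "GDERIV f x :> D"
  shows "f y \<ge> f x + D \<bullet> (y - x)"
proof -
  define \<phi> where "\<phi> = (\<lambda>s::real. f (x + s *\<^sub>R (y - x)))"
  have "convex_on UNIV \<phi>"
  proof (rule convex_onI)
    fix t s r :: real
    assume t: "0 < t" "t < 1"
    have "x + ((1 - t) *\<^sub>R s + t *\<^sub>R r) *\<^sub>R (y - x)
      = (1 - t) *\<^sub>R (x + s *\<^sub>R (y - x)) + t *\<^sub>R (x + r *\<^sub>R (y - x))"
      by (simp add: algebra_simps)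
    then show "\<phi> ((1 - t) *\<^sub>R s + t *\<^sub>R r) \<le> (1 - t) * \<phi> s + t * \<phi> r"
      unfolding \<phi>_def using convex_onD[OF conv, of t] t by simp
  qed simp
  moreover have "(\<phi> has_real_derivative D \<bullet> (y - x)) (at 0)"
    unfolding \<phi>_def using D by (intro GDERIV_along_line) simp
  ultimately have "\<phi> 1 - \<phi> 0 \<ge> D \<bullet> (y - x) * (1 - 0)"
    by (intro convex_on_imp_above_tangent[of UNIV]) auto
  then show ?thesis
    by (simp add: \<phi>_def)
qed

lemma GDERIV_half_square_dist:
  "GDERIV (\<lambda>y. H / 2 * (norm (y - c))\<^sup>2) y :> H *\<^sub>R (y - c)"
proof -
  have "((\<lambda>y. (y - c) \<bullet> (y - c)) has_derivative (\<lambda>h. (y - c) \<bullet> (h - 0) + (h - 0) \<bullet> (y - c))) (at y)"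
    by (intro has_derivative_inner has_derivative_diff has_derivative_ident has_derivative_const)
  then have "((\<lambda>y. H / 2 * ((y - c) \<bullet> (y - c))) has_derivative
      (\<lambda>h. H / 2 * ((y - c) \<bullet> (h - 0) + (h - 0) \<bullet> (y - c)))) (at y)"
    by (rule has_derivative_mult_right)
  moreover have "(\<lambda>h. H / 2 * ((y - c) \<bullet> (h - 0) + (h - 0) \<bullet> (y - c))) = (\<lambda>h. h \<bullet> H *\<^sub>R (y - c))"
    by (simp add: fun_eq_iff inner_commute[of "y - c"])
  ultimately show ?thesis
    unfolding gderiv_def power2_norm_eq_inner by simp
qed

subsection \<open>The auxiliary problem\<close>

locale smooth_convex =
  fixes f :: "'a::euclidean_space \<Rightarrow> real" and L H :: real and xs :: 'a
  assumes diff: "\<And>x. f differentiable (at x)"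
    and conv: "convex_on UNIV f"
    and minimizer: "\<And>x. f xs \<le> f x"
    and grad_lipschitz: "L-lipschitz_on UNIV (grad f)"
    and H_pos: "H > 0"
begin

text \<open>This is F_k when \<open>c\<close> is the k-th centre. The centres are random, so
  \<open>c\<close> stays a free argument and all bounds are uniform in it.\<close>

definition aux :: "'a \<Rightarrow> 'a \<Rightarrow> real" where
  "aux c y = f y + H / 2 * (norm (y - c))\<^sup>2"

lemma L_nonneg: "0 \<le> L"
  using grad_lipschitz by (rule lipschitz_on_nonneg)

lemma GDERIV_f: "GDERIV f x :> grad f x"
  by (rule GDERIV_grad[OF diff])

lemma GDERIV_aux: "GDERIV (aux c) y :> grad f y + H *\<^sub>R (y - c)"
  unfolding aux_def by (intro GDERIV_add GDERIV_f GDERIV_half_square_dist)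

lemma grad_aux: "grad (aux c) y = grad f y + H *\<^sub>R (y - c)"
  by (rule grad_eqI[OF GDERIV_aux])

lemma above_tangent: "f y \<ge> f x + grad f x \<bullet> (y - x)"
  by (rule convex_above_tangent_plane[OF conv GDERIV_f])

text \<open>The proximal term equals its own second-order expansion, so it contributes exactly the
  quadratic term to the tangent inequality of \<open>f\<close>.\<close>

lemma aux_strongly_convex:
  "aux c y \<ge> aux c x + grad (aux c) x \<bullet> (y - x) + H / 2 * (norm (y - x))\<^sup>2"
proof -
  have "(norm (y - c))\<^sup>2 = (norm (x - c))\<^sup>2 + 2 * ((x - c) \<bullet> (y - x)) + (norm (y - x))\<^sup>2"
    unfolding power2_norm_eq_inner by (simp add: algebra_simps inner_commute)
  then have "H / 2 * (norm (y - c))\<^sup>2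
      = H / 2 * (norm (x - c))\<^sup>2 + H * ((x - c) \<bullet> (y - x)) + H / 2 * (norm (y - x))\<^sup>2"
    by (simp add: distrib_left)
  then show ?thesis
    using above_tangent[of x y] unfolding aux_def grad_aux inner_add_left inner_scaleR_left by linarith
qed

lemma grad_aux_lipschitz: "norm (grad (aux c) x - grad (aux c) y) \<le> (L + H) * norm (x - y)"
proof -
  have "norm (grad (aux c) x - grad (aux c) y) = norm ((grad f x - grad f y) + H *\<^sub>R (x - y))"
    by (simp add: grad_aux algebra_simps)
  also have "\<dots> \<le> norm (grad f x - grad f y) + norm (H *\<^sub>R (x - y))"
    by (rule norm_triangle_ineq)
  also have "\<dots> \<le> (L + H) * norm (x - y)"
    using lipschitz_onD[OF grad_lipschitz, of x y] H_pos by (simp add: dist_norm distrib_right)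
  finally show ?thesis .
qed

lemma aux_minimizer:
  obtains ys where "\<And>y. aux c ys \<le> aux c y" "grad (aux c) ys = 0"
proof -
  \<comment> \<open>This radius puts \<open>xs\<close> on the boundary sphere: outside the ball both
    \<open>f\<close> and the proximal term are at least as large as at \<open>xs\<close>, so the
    minimum over the compact ball is global.\<close>
  define r where "r = norm (xs - c)"
  have cont: "continuous_on (cball c r) (aux c)"
    using GDERIV_aux[of c]
    by (intro continuous_at_imp_continuous_on) (auto simp: gderiv_def dest: has_derivative_continuous)
  have "cball c r \<noteq> {}"
    by (simp add: r_def)
  then obtain ys where ys: "\<And>y. y \<in> cball c r \<Longrightarrow> aux c ys \<le> aux c y"
    using continuous_attains_inf[OF compact_cball _ cont] by blast
  have min: "aux c ys \<le> aux c y" for y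
  proof (cases "y \<in> cball c r")
    case False
    then have "r \<le> norm (y - c)"
      by (simp add: dist_norm norm_minus_commute)
    then have "(norm (xs - c))\<^sup>2 \<le> (norm (y - c))\<^sup>2"
      by (simp add: r_def power_mono)
    then have "aux c xs \<le> aux c y"
      unfolding aux_def using minimizer[of y] H_pos by (intro add_mono mult_left_mono) auto
    moreover have "aux c ys \<le> aux c xs"
      by (rule ys) (simp add: r_def dist_norm norm_minus_commute)
    ultimately show ?thesis by simp
  qed (rule ys)
  have "(\<lambda>h. h \<bullet> grad (aux c) ys) = (\<lambda>h. 0)"
    using differential_zero_maxmin[of ys UNIV "aux c"] GDERIV_aux[of c ys] min
    unfolding grad_aux gderiv_def by blast
  then have "grad (aux c) ys = 0"
    by (metis inner_eq_zero_iff)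
  with min show ?thesis
    by (rule that)
qed

text \<open>As the gradient vanishes at \<open>ys\<close>, its Lipschitz bound controls the gradient
  itself along the segment, and the quadratic upper bound at parameter 1 has no linear term.\<close>

lemma aux_gap_le_dist:
  assumes "grad (aux c) ys = 0"
  shows "aux c y - aux c ys \<le> (L + H) / 2 * (norm (y - ys))\<^sup>2"
proof -
  define \<phi> where "\<phi> = (\<lambda>s. aux c (ys + s *\<^sub>R (y - ys)))"
  define \<phi>' where "\<phi>' = (\<lambda>s. grad (aux c) (ys + s *\<^sub>R (y - ys)) \<bullet> (y - ys))"
  have "(\<phi> has_real_derivative \<phi>' t) (at t)" for t
    unfolding \<phi>_def \<phi>'_def grad_aux by (intro GDERIV_along_line GDERIV_aux)
  moreover have "\<bar>\<phi>' t - \<phi>' 0\<bar> \<le> ((L + H) * (norm (y - ys))\<^sup>2) * \<bar>t\<bar>" for t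
  proof -
    have "\<bar>\<phi>' t - \<phi>' 0\<bar> = \<bar>grad (aux c) (ys + t *\<^sub>R (y - ys)) \<bullet> (y - ys)\<bar>"
      using assms by (simp add: \<phi>'_def)
    also have "\<dots> \<le> norm (grad (aux c) (ys + t *\<^sub>R (y - ys))) * norm (y - ys)"
      by (rule Cauchy_Schwarz_ineq2)
    also have "\<dots> \<le> ((L + H) * norm (t *\<^sub>R (y - ys))) * norm (y - ys)"
      using grad_aux_lipschitz[of c "ys + t *\<^sub>R (y - ys)" ys] assms by (intro mult_right_mono) auto
    finally show ?thesis
      by (simp add: power2_eq_square mult_ac)
  qed
  ultimately have "\<phi> 1 \<le> \<phi> 0 + \<phi>' 0 * 1 + ((L + H) * (norm (y - ys))\<^sup>2) / 2 * 1\<^sup>2"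
    by (rule quadratic_upper_bound)
  then show ?thesis
    using assms by (simp add: \<phi>_def \<phi>'_def)
qed

lemma dist_le_aux_gap:
  assumes "grad (aux c) ys = 0"
  shows "H / 2 * (norm (y - ys))\<^sup>2 \<le> aux c y - aux c ys"
  using aux_strongly_convex[of c ys y] assms by simp

text \<open>The Polyak-Lojasiewicz inequality: minimize the strong convexity bound over \<open>y\<close>.\<close>

lemma aux_gap_le_grad:
  "2 * H * (aux c y - aux c ys) \<le> (norm (grad (aux c) y))\<^sup>2"
proof -
  let ?g = "grad (aux c) y"
  have "0 \<le> (norm (?g + H *\<^sub>R (ys - y)))\<^sup>2"
    by simp
  also have "\<dots> = (norm ?g)\<^sup>2 + 2 * H * (?g \<bullet> (ys - y) + H / 2 * (norm (ys - y))\<^sup>2)"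
    unfolding power2_norm_eq_inner
    by (simp add: inner_add_left inner_add_right inner_commute algebra_simps power2_eq_square)
  also have "\<dots> \<le> (norm ?g)\<^sup>2 + 2 * H * (aux c ys - aux c y)"
    using aux_strongly_convex[of c y ys] H_pos by (intro add_left_mono mult_left_mono) auto
  finally show ?thesis
    by (simp add: algebra_simps)
qed

lemma aux_gap_imp_inexact_solution:
  assumes crit: "grad (aux c) ys = 0"
    and gap: "aux c v - aux c ys \<le> H / 2 * (norm (c - ys) / (3 + 2 * L / H))\<^sup>2"
  shows "norm (grad (aux c) v) \<le> H / 2 * norm (v - c)"
proof -
  let ?q = "3 + 2 * L / H"
  have q: "?q > 0"
    using L_nonneg H_pos by (intro add_pos_nonneg) auto
  have "H / 2 * (norm (v - ys))\<^sup>2 \<le> H / 2 * (norm (c - ys) / ?q)\<^sup>2"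
    using dist_le_aux_gap[OF crit, of v] gap by linarith
  then have "(norm (v - ys))\<^sup>2 \<le> (norm (c - ys) / ?q)\<^sup>2"
    using H_pos by simp
  then have "norm (v - ys) \<le> norm (c - ys) / ?q"
    by (rule power2_le_imp_le) (use q in auto)
  then have "norm (v - ys) * ?q \<le> norm (c - ys)"
    using q by (simp add: pos_le_divide_eq)
  then have "H * (norm (v - ys) * ?q) \<le> H * norm (c - ys)"
    using H_pos by simp
  \<comment> \<open>Origin of the factor 3 + 2 L / H: the part 2 (L + H) is twice the Lipschitz
    constant of the gradient, and the spare H pays for the triangle inequality that replaces
    \<open>norm (c - ys)\<close> by \<open>norm (v - c)\<close>.\<close>
  moreover have "H * (norm (v - ys) * ?q) = 2 * ((L + H) * norm (v - ys)) + H * norm (v - ys)"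
    using H_pos by (simp add: field_simps)
  moreover have "norm (c - ys) \<le> norm (v - c) + norm (v - ys)"
    using norm_triangle_ineq[of "c - v" "v - ys"] by (simp add: norm_minus_commute)
  then have "H * norm (c - ys) \<le> H * norm (v - c) + H * norm (v - ys)"
    using H_pos by (simp flip: distrib_left)
  ultimately show ?thesis
    using grad_aux_lipschitz[of c v ys] crit by simp
qed

subsection \<open>The outer method\<close>

text \<open>Adds the tangent inequalities at \<open>v'\<close> towards \<open>v\<close> and
  \<open>xs\<close>, with weights \<open>A\<close> and \<open>a\<close>, to the expanded square. The
  equation for \<open>a\<close> gives the squared gradient the weight (A + a) / (4 H), and the
  inexactness condition makes the remainder nonpositive.\<close>

lemma potential_step:
  assumes a: "a\<^sup>2 = (A + a) / (2 * H)" and A: "A \<ge> 0" "a > 0"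
    and xt: "xt = (1 / (A + a)) *\<^sub>R (A *\<^sub>R v + a *\<^sub>R x)"
    and v': "norm (grad (aux xt) v') \<le> H / 2 * norm (v' - xt)"
  shows "(A + a) * (f v' - f xs) + (norm (x - a *\<^sub>R grad f v' - xs))\<^sup>2 / 2
    \<le> A * (f v - f xs) + (norm (x - xs))\<^sup>2 / 2"
proof -
  define g where "g = grad f v'"
  define w where "w = v' - xt"
  \<comment> \<open>The right side has norm at most 3/2 H \<open>norm w\<close>. Relaxing this to 2
    H \<open>norm w\<close> makes the squares of \<open>norm w\<close> cancel after squaring,
    leaving \<open>(norm g)\<^sup>2 + 4 * H * (g \<bullet> w) \<le> 0\<close>.\<close>
  have "g + (2 * H) *\<^sub>R w = grad (aux xt) v' + H *\<^sub>R w"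
    unfolding grad_aux g_def w_def mult_2 scaleR_add_left by (simp only: add.assoc)
  then have "norm (g + (2 * H) *\<^sub>R w) \<le> norm (grad (aux xt) v') + norm (H *\<^sub>R w)"
    by (simp only: norm_triangle_ineq)
  also have "\<dots> \<le> 2 * H * norm w"
  proof -
    have "0 \<le> H * norm w" "norm (H *\<^sub>R w) = H * norm w"
      using H_pos by simp_all
    then show ?thesis
      using v' unfolding w_def by linarith
  qed
  finally have "(norm (g + (2 * H) *\<^sub>R w))\<^sup>2 \<le> (2 * H * norm w)\<^sup>2"
    by (simp add: power_mono)
  then have "(norm g)\<^sup>2 + 4 * H * (g \<bullet> w) \<le> 0"
    unfolding power2_norm_eq_inner power_mult_distrib
    by (simp add: inner_add_left inner_add_right inner_commute power2_eq_square)
  then have gw: "(A + a) / (4 * H) * ((norm g)\<^sup>2 + 4 * H * (g \<bullet> w)) \<le> 0"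
    using A H_pos by (intro mult_nonneg_nonpos) auto
  have "(norm (d - a *\<^sub>R g))\<^sup>2 = (norm d)\<^sup>2 - 2 * a * (g \<bullet> d) + a\<^sup>2 * (norm g)\<^sup>2" for d
    unfolding power2_norm_eq_inner
    by (simp add: inner_diff_left inner_diff_right inner_commute[of d g] power2_eq_square right_diff_distrib)
  from this[of "x - xs"] have "(norm (x - a *\<^sub>R g - xs))\<^sup>2 = (norm (x - xs))\<^sup>2 - 2 * a * (g \<bullet> (x - xs)) + a\<^sup>2 * (norm g)\<^sup>2"
    by (simp add: diff_diff_eq add.commute[of xs])
  then have sq: "(norm (x - a *\<^sub>R g - xs))\<^sup>2 / 2
      = (norm (x - xs))\<^sup>2 / 2 - a * (g \<bullet> (x - xs)) + (A + a) / (4 * H) * (norm g)\<^sup>2"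
  proof -
    have "a\<^sup>2 * (norm g)\<^sup>2 = 2 * ((A + a) / (4 * H) * (norm g)\<^sup>2)"
      unfolding a by simp
    then show ?thesis
      using \<open>(norm (x - a *\<^sub>R g - xs))\<^sup>2 = _\<close> by linarith
  qed
  have t1: "A * (f v' + g \<bullet> (v - v')) \<le> A * f v"
    unfolding g_def using A above_tangent[of v' v] by (intro mult_left_mono) auto
  have t2: "a * (f v' + g \<bullet> (xs - v')) \<le> a * f xs"
    unfolding g_def using A above_tangent[of v' xs] by (intro mult_left_mono) auto
  \<comment> \<open>Because \<open>xt\<close> is the weighted mean of \<open>v\<close> and
    \<open>x\<close>, the linear terms of the two tangent inequalities and of the expanded square
    combine into a multiple of \<open>g \<bullet> w\<close>.\<close>
  have "(A + a) *\<^sub>R xt = A *\<^sub>R v + a *\<^sub>R x"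
    using A by (simp add: xt)
  then have "(A + a) *\<^sub>R w = (A + a) *\<^sub>R v' - A *\<^sub>R v - a *\<^sub>R x"
    by (simp add: w_def scaleR_diff_right)
  then have "g \<bullet> ((A + a) *\<^sub>R w) = g \<bullet> ((A + a) *\<^sub>R v' - A *\<^sub>R v - a *\<^sub>R x)"
    by simp
  then have "(A + a) * (g \<bullet> w) = - (A * (g \<bullet> (v - v'))) - a * (g \<bullet> (xs - v')) - a * (g \<bullet> (x - xs))"
    by (simp add: inner_diff_right algebra_simps)
  moreover have "(A + a) / (4 * H) * ((norm g)\<^sup>2 + 4 * H * (g \<bullet> w))
      = (A + a) / (4 * H) * (norm g)\<^sup>2 + (A + a) * (g \<bullet> w)"
    using H_pos by (simp add: field_simps)
  ultimately show ?thesis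
    using gw sq t1 t2 unfolding g_def[symmetric] by (simp add: algebra_simps)
qed

end

section \<open>Step sizes and their growth\<close>

lemma meta_a_pos:
  assumes "H > 0" "A \<ge> 0"
  shows "meta_a H A > 0"
proof -
  have "0 < 1 / (2 * H)" using assms by simp
  then show ?thesis
    unfolding meta_a_def Let_def using assms by (intro divide_pos_pos add_pos_nonneg) auto
qed

text \<open>The step is the positive root of a quadratic equation in a; this is the form that
  \<open>potential_step\<close> requires.\<close>

lemma meta_a_square:
  assumes "H > 0" "A \<ge> 0"
  shows "(meta_a H A)\<^sup>2 = (A + meta_a H A) / (2 * H)"
proof -
  define l where "l = 1 / (2 * H)"
  define s where "s = sqrt (l\<^sup>2 + 4 * l * A)"
  have l: "l > 0" using assms by (simp add: l_def)
  have s: "s\<^sup>2 = l\<^sup>2 + 4 * l * A"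
    unfolding s_def using l assms by simp
  have a: "meta_a H A = (l + s) / 2"
    by (simp add: meta_a_def Let_def l_def s_def)
  have "(meta_a H A)\<^sup>2 = l * (A + meta_a H A)"
    unfolding a using s by (simp add: power2_eq_square field_simps)
  then show ?thesis
    by (simp add: l_def)
qed

text \<open>With l = 1 / (2 H), the bound l k^2 / 4 on the current sum makes the square root at
  least l k, so the increment is at least l (k + 1) / 2. This reaches l (k + 1)^2 / 4 with l / 4 to
  spare.\<close>

lemma meta_A_ge:
  assumes "H > 0"
  shows "meta_A H k \<ge> (real k)\<^sup>2 / (8 * H)"
proof (induction k)
  case (Suc k)
  define l where "l = 1 / (2 * H)"
  have l: "l > 0" using assms by (simp add: l_def)
  have A: "meta_A H k \<ge> l * (real k)\<^sup>2 / 4"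
    using Suc by (simp add: l_def)
  have "(l * k)\<^sup>2 \<le> l\<^sup>2 + 4 * l * meta_A H k"
  proof -
    have "(l * k)\<^sup>2 = 4 * l * (l * (real k)\<^sup>2 / 4)"
      by (simp add: power2_eq_square)
    also have "\<dots> \<le> 4 * l * meta_A H k"
      using A l by (intro mult_left_mono) auto
    finally show ?thesis by (simp add: add_increasing)
  qed
  then have "l * k \<le> sqrt (l\<^sup>2 + 4 * l * meta_A H k)"
    by (rule real_le_rsqrt)
  then have "meta_a H (meta_A H k) \<ge> (l + l * k) / 2"
    by (simp add: meta_a_def Let_def l_def)
  then have "meta_A H (Suc k) \<ge> l * (real k)\<^sup>2 / 4 + (l + l * k) / 2"
    using A unfolding meta_A.simps by (intro add_mono)
  also have "l * (real k)\<^sup>2 / 4 + (l + l * k) / 2 = l * (real (Suc k))\<^sup>2 / 4 + l / 4"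
    by (simp add: power2_eq_square field_simps)
  finally have "l * (real (Suc k))\<^sup>2 / 4 \<le> meta_A H (Suc k)"
    using l by linarith
  then show ?case
    by (simp add: l_def)
qed simp

lemma meta_A_nonneg: "H > 0 \<Longrightarrow> meta_A H k \<ge> 0"
  using meta_A_ge[of H k] by (rule order_trans[rotated]) simp_all

section \<open>Failure probability of the outer method\<close>

lemma emeasure_Compl_le_iff:
  assumes "0 \<le> b"
  shows "emeasure (measure_pmf p) (- S) \<le> ennreal b \<longleftrightarrow> measure_pmf.prob p S \<ge> 1 - b"
proof -
  have "measure_pmf.prob p (- S) = 1 - measure_pmf.prob p S"
    using measure_pmf.prob_compl[of S p] by (simp add: Compl_eq_Diff_UNIV)
  then show ?thesis
    using assms by (auto simp: measure_pmf.emeasure_eq_measure)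
qed

text \<open>Union bound for a second experiment whose law depends on the first outcome: its failure
  probability is at most 1 on the bad outcomes and at most \<eta> on the good ones.\<close>

lemma prob_bind_pmf_ge:
  assumes p: "measure_pmf.prob p G \<ge> 1 - \<alpha>"
    and q: "\<And>s. s \<in> G \<Longrightarrow> measure_pmf.prob (q s) G' \<ge> 1 - \<eta>"
    and nonneg: "0 \<le> \<alpha>" "0 \<le> \<eta>"
  shows "measure_pmf.prob (bind_pmf p q) G' \<ge> 1 - (\<alpha> + \<eta>)"
proof -
  have "emeasure (measure_pmf (bind_pmf p q)) (- G') = (\<integral>\<^sup>+s. emeasure (measure_pmf (q s)) (- G') \<partial>p)"
    by simp
  also have "\<dots> \<le> (\<integral>\<^sup>+s. indicator (- G) s + ennreal \<eta> \<partial>p)"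
  proof (intro nn_integral_mono)
    fix s
    show "emeasure (measure_pmf (q s)) (- G') \<le> indicator (- G) s + ennreal \<eta>"
    proof (cases "s \<in> G")
      case True
      then show ?thesis
        using q[OF True] emeasure_Compl_le_iff[OF nonneg(2), of "q s" G'] by simp
    next
      case False
      then show ?thesis
        using measure_pmf.emeasure_le_1[of "q s" "- G'"] by (simp add: add_increasing2)
    qed
  qed
  also have "\<dots> = emeasure (measure_pmf p) (- G) + ennreal \<eta>"
    by (simp add: nn_integral_add)
  also have "\<dots> \<le> ennreal \<alpha> + ennreal \<eta>"
    using p emeasure_Compl_le_iff[OF nonneg(1)] by (intro add_right_mono) blast
  also have "\<dots> = ennreal (\<alpha> + \<eta>)"
    using nonneg by simp
  finally show ?thesis
    using nonneg by (simp only: emeasure_Compl_le_iff add_nonneg_nonneg)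
qed

context smooth_convex
begin

text \<open>Equality holds at the start since \<open>meta_A H 0 = 0\<close>, and every outer step
  adds \<eta> to the failure probability. The inner solver is abstract, but its guarantee must cover
  every centre because the centre depends on earlier random choices.\<close>

lemma accel_meta_potential:
  assumes solve: "\<And>c. measure_pmf.prob (solve (aux c) c)
      {v. norm (grad (aux c) v) \<le> H / 2 * norm (v - c)} \<ge> 1 - \<eta>"
    and \<eta>: "\<eta> \<ge> 0"
  shows "measure_pmf.prob (accel_meta solve f H x0 k)
    {(x, v). meta_A H k * (f v - f xs) + (norm (x - xs))\<^sup>2 / 2 \<le> (norm (x0 - xs))\<^sup>2 / 2} \<ge> 1 - k * \<eta>"
proof (induction k)
  case 0
  then show ?case by simp
next
  case (Suc k)
  define G where "G = (\<lambda>k. {(x, v). meta_A H k * (f v - f xs) + (norm (x - xs))\<^sup>2 / 2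
    \<le> (norm (x0 - xs))\<^sup>2 / 2})"
  define A where "A = meta_A H k"
  define a where "a = meta_a H A"
  \<comment> \<open>One outer iteration as a kernel on the pair (x, v), so that the recursion
    becomes a plain bind.\<close>
  define q where "q = (\<lambda>(x, v). let xt = (1 / (A + a)) *\<^sub>R (A *\<^sub>R v + a *\<^sub>R x) in
    map_pmf (\<lambda>v'. (x - a *\<^sub>R grad f v', v')) (solve (aux xt) xt))"
  have A: "A \<ge> 0"
    unfolding A_def by (rule meta_A_nonneg[OF H_pos])
  have step: "measure_pmf.prob (q s) (G (Suc k)) \<ge> 1 - \<eta>" if s: "s \<in> G k" for s
  proof -
    obtain x v where s_eq: "s = (x, v)"
      by fastforce
    define xt where "xt = (1 / (A + a)) *\<^sub>R (A *\<^sub>R v + a *\<^sub>R x)"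
    have "{v'. norm (grad (aux xt) v') \<le> H / 2 * norm (v' - xt)}
        \<subseteq> (\<lambda>v'. (x - a *\<^sub>R grad f v', v')) -` G (Suc k)"
    proof (rule subsetI)
      fix v' assume "v' \<in> {v'. norm (grad (aux xt) v') \<le> H / 2 * norm (v' - xt)}"
      then have "(A + a) * (f v' - f xs) + (norm (x - a *\<^sub>R grad f v' - xs))\<^sup>2 / 2
          \<le> A * (f v - f xs) + (norm (x - xs))\<^sup>2 / 2"
        using meta_a_square[OF H_pos A] meta_a_pos[OF H_pos A] A
        by (intro potential_step[where xt = xt]) (simp_all add: a_def xt_def)
      then show "v' \<in> (\<lambda>v'. (x - a *\<^sub>R grad f v', v')) -` G (Suc k)"
        using s by (simp add: G_def s_eq A_def a_def)
    qed
    then have "measure_pmf.prob (solve (aux xt) xt) {v'. norm (grad (aux xt) v') \<le> H / 2 * norm (v' - xt)}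
        \<le> measure_pmf.prob (q s) (G (Suc k))"
      by (simp add: q_def s_eq Let_def flip: xt_def)
        (intro measure_pmf.finite_measure_mono; simp)
    with solve[of xt] show ?thesis
      by linarith
  qed
  have "accel_meta solve f H x0 (Suc k) = bind_pmf (accel_meta solve f H x0 k) q"
    by (simp add: q_def A_def a_def aux_def[abs_def] map_pmf_def Let_def split_def)
  moreover have "measure_pmf.prob (bind_pmf (accel_meta solve f H x0 k) q) (G (Suc k)) \<ge> 1 - (k * \<eta> + \<eta>)"
    using Suc \<eta> step by (intro prob_bind_pmf_ge[where G = "G k"]) (auto simp: G_def)
  ultimately have "measure_pmf.prob (accel_meta solve f H x0 (Suc k)) (G (Suc k)) \<ge> 1 - (k * \<eta> + \<eta>)"
    by (simp only:)
  then show ?case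
    unfolding G_def of_nat_Suc by (simp only: distrib_right mult_1 add.commute)
qed

end

subsection \<open>Coordinate descent\<close>

locale coord_smooth_convex = smooth_convex f L H xs
  for f :: "real^'n \<Rightarrow> real" and L H :: real and xs :: "real^'n" +
  fixes Lc :: "'n \<Rightarrow> real"
  assumes coord_lipschitz:
    "\<And>i x u. \<bar>grad f (x + u *\<^sub>R axis i 1) $ i - grad f x $ i\<bar> \<le> Lc i * \<bar>u\<bar>"
begin

abbreviation Z :: real where
  "Z \<equiv> \<Sum>i\<in>UNIV. H + Lc i"

text \<open>The coordinate bound at \<open>u = 1\<close> forces \<open>Lc i\<close> to be
  nonnegative.\<close>

lemma step_pos: "0 < H + Lc i"
  using coord_lipschitz[of 0 1 i] H_pos by simp

lemma Z_pos: "0 < Z"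
  using step_pos by (simp add: sum_pos)

text \<open>Along axis \<open>i\<close> the slope is Lipschitz with constant
  \<open>H + Lc i\<close>, and the step goes to the minimizer of the resulting quadratic upper
  model.\<close>

lemma aux_coord_step:
  "aux c (y - (1 / (H + Lc i) * (grad (aux c) y $ i)) *\<^sub>R axis i 1)
    \<le> aux c y - (grad (aux c) y $ i)\<^sup>2 / (2 * (H + Lc i))"
proof -
  define M where "M = H + Lc i"
  define g where "g = grad (aux c) y $ i"
  define \<phi> where "\<phi> = (\<lambda>s. aux c (y + s *\<^sub>R axis i 1))"
  define \<phi>' where "\<phi>' = (\<lambda>s. grad (aux c) (y + s *\<^sub>R axis i 1) $ i)"
  have M: "M > 0"
    by (simp add: M_def step_pos)
  have "(\<phi> has_real_derivative \<phi>' t) (at t)" for t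
    unfolding \<phi>_def \<phi>'_def grad_aux
    using GDERIV_along_line[OF GDERIV_aux[of c "y + t *\<^sub>R axis i 1"]] by (simp add: inner_axis)
  moreover have "\<bar>\<phi>' t - \<phi>' 0\<bar> \<le> M * \<bar>t\<bar>" for t
  proof -
    have "\<phi>' t - \<phi>' 0 = (grad f (y + t *\<^sub>R axis i 1) $ i - grad f y $ i) + H * t"
      by (simp add: \<phi>'_def grad_aux axis_def algebra_simps)
    also have "\<bar>\<dots>\<bar> \<le> Lc i * \<bar>t\<bar> + \<bar>H * t\<bar>"
      using coord_lipschitz[of y t i] by linarith
    finally show ?thesis
      using H_pos by (simp add: M_def abs_mult algebra_simps)
  qed
  ultimately have "\<phi> (- (g / M)) \<le> \<phi> 0 + \<phi>' 0 * (- (g / M)) + M / 2 * (- (g / M))\<^sup>2"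
    by (rule quadratic_upper_bound)
  also have "\<dots> = aux c y - g\<^sup>2 / (2 * M)"
    using M by (simp add: \<phi>_def \<phi>'_def g_def power2_eq_square field_simps)
  finally show ?thesis
    by (simp add: \<phi>_def M_def g_def)
qed

text \<open>The sampling weight of \<open>i\<close> cancels the denominator \<open>H + Lc i\<close>
  of the guaranteed decrease. The expected decrease is thus at least the full squared gradient norm
  over 2 Z, to which the Polyak-Lojasiewicz inequality applies.\<close>

lemma nn_integral_coord_step:
  assumes min: "\<And>y. aux c ys \<le> aux c y"
  shows "(\<integral>\<^sup>+i. ennreal (aux c (y - (1 / (H + Lc i) * (grad (aux c) y $ i)) *\<^sub>R axis i 1) - aux c ys)
      \<partial>index_pmf H Lc) \<le> ennreal (exp (- H / Z) * (aux c y - aux c ys))"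
proof -
  let ?g = "grad (aux c) y"
  have gap: "0 \<le> aux c y - aux c ys" for y
    using min[of y] by simp
  have pmf: "pmf (index_pmf H Lc) i = (H + Lc i) / Z" for i
    by (rule pmf_index_pmf[OF step_pos])
  have "(\<integral>\<^sup>+i. ennreal (aux c (y - (1 / (H + Lc i) * (?g $ i)) *\<^sub>R axis i 1) - aux c ys) \<partial>index_pmf H Lc)
      = (\<Sum>i\<in>UNIV. ennreal ((H + Lc i) / Z * (aux c (y - (1 / (H + Lc i) * (?g $ i)) *\<^sub>R axis i 1) - aux c ys)))"
    unfolding nn_integral_measure_pmf
    using step_pos Z_pos
    by (subst nn_integral_count_space_finite)
      (auto simp: pmf less_imp_le simp del: times_divide_eq_left intro!: sum.cong ennreal_mult'[symmetric])
  also have "\<dots> = ennreal (\<Sum>i\<in>UNIV. (H + Lc i) / Z * (aux c (y - (1 / (H + Lc i) * (?g $ i)) *\<^sub>R axis i 1) - aux c ys))"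
    using gap step_pos Z_pos by (intro sum_ennreal) (simp add: less_imp_le)
  also have "\<dots> \<le> ennreal (exp (- H / Z) * (aux c y - aux c ys))"
  proof (rule ennreal_leI)
    have "(\<Sum>i\<in>UNIV. (H + Lc i) / Z * (aux c (y - (1 / (H + Lc i) * (?g $ i)) *\<^sub>R axis i 1) - aux c ys))
        \<le> (\<Sum>i\<in>UNIV. (H + Lc i) / Z * (aux c y - (?g $ i)\<^sup>2 / (2 * (H + Lc i)) - aux c ys))"
      using step_pos Z_pos aux_coord_step[of c y]
      by (intro sum_mono mult_left_mono) (auto simp: less_imp_le)
    also have "\<dots> = (\<Sum>i\<in>UNIV. (H + Lc i) * ((aux c y - aux c ys) / Z) - (?g $ i)\<^sup>2 / (2 * Z))"
    proof (rule sum.cong[OF refl])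
      have "m / z * (p - g / (2 * m) - r) = m * ((p - r) / z) - g / (2 * z)"
        if "m > 0" "z > 0" for m z p g r :: real
        using that by (simp add: field_simps)
      then show "(H + Lc i) / Z * (aux c y - (?g $ i)\<^sup>2 / (2 * (H + Lc i)) - aux c ys)
        = (H + Lc i) * ((aux c y - aux c ys) / Z) - (?g $ i)\<^sup>2 / (2 * Z)" for i
        using step_pos Z_pos by blast
    qed
    also have "\<dots> = Z * ((aux c y - aux c ys) / Z) - (norm ?g)\<^sup>2 / (2 * Z)"
      unfolding sum_subtractf sum_distrib_right[symmetric] sum_divide_distrib[symmetric]
      by (simp add: norm_vec_def L2_set_def sum_nonneg)
    also have "\<dots> \<le> (aux c y - aux c ys) - 2 * H * (aux c y - aux c ys) / (2 * Z)"
      using aux_gap_le_grad[of c y ys] Z_pos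
      by (intro diff_mono divide_right_mono) auto
    also have "\<dots> = (1 + - H / Z) * (aux c y - aux c ys)"
      using Z_pos by (simp add: divide_simps) (simp add: algebra_simps)
    also have "\<dots> \<le> exp (- H / Z) * (aux c y - aux c ys)"
      using gap by (intro mult_right_mono exp_ge_add_one_self) auto
    finally show "(\<Sum>i\<in>UNIV. (H + Lc i) / Z * (aux c (y - (1 / (H + Lc i) * (?g $ i)) *\<^sub>R axis i 1) - aux c ys))
      \<le> exp (- H / Z) * (aux c y - aux c ys)" .
  qed
  finally show ?thesis .
qed

lemma nn_integral_coord_descent:
  assumes min: "\<And>y. aux c ys \<le> aux c y"
  shows "(\<integral>\<^sup>+y. ennreal (aux c y - aux c ys) \<partial>coord_descent H Lc j (aux c) y0)
    \<le> ennreal (exp (- real j * H / Z) * (aux c y0 - aux c ys))"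
proof (induction j)
  case 0
  then show ?case by simp
next
  case (Suc j)
  have "(\<integral>\<^sup>+y. ennreal (aux c y - aux c ys) \<partial>coord_descent H Lc (Suc j) (aux c) y0)
      = (\<integral>\<^sup>+y. (\<integral>\<^sup>+i. ennreal (aux c (y - (1 / (H + Lc i) * (grad (aux c) y $ i)) *\<^sub>R axis i 1) - aux c ys)
          \<partial>index_pmf H Lc) \<partial>coord_descent H Lc j (aux c) y0)"
    by simp
  also have "\<dots> \<le> (\<integral>\<^sup>+y. ennreal (exp (- H / Z)) * ennreal (aux c y - aux c ys) \<partial>coord_descent H Lc j (aux c) y0)"
    using nn_integral_coord_step[OF min] by (intro nn_integral_mono) (simp add: ennreal_mult')
  also have "\<dots> = ennreal (exp (- H / Z)) * (\<integral>\<^sup>+y. ennreal (aux c y - aux c ys) \<partial>coord_descent H Lc j (aux c) y0)"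
    by (rule nn_integral_cmult) simp
  also have "\<dots> \<le> ennreal (exp (- H / Z)) * ennreal (exp (- real j * H / Z) * (aux c y0 - aux c ys))"
    by (intro mult_left_mono Suc) simp
  also have "\<dots> = ennreal ((exp (- H / Z) * exp (- real j * H / Z)) * (aux c y0 - aux c ys))"
    by (simp add: ennreal_mult' mult.assoc)
  also have "exp (- H / Z) * exp (- real j * H / Z) = exp (- real (Suc j) * H / Z)"
    by (simp add: algebra_simps add_divide_distrib diff_divide_distrib flip: exp_add)
  finally show ?case .
qed

end

section \<open>Markov's inequality and the success of one inner run\<close>

lemma prob_le_of_nn_integral_le:
  fixes X :: "'b \<Rightarrow> real"
  assumes int: "(\<integral>\<^sup>+y. ennreal (X y) \<partial>measure_pmf p) \<le> ennreal (\<eta> * t)"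
    and "0 \<le> t" "0 \<le> \<eta>"
  shows "measure_pmf.prob p {y. X y \<le> t} \<ge> 1 - \<eta>"
\<comment> \<open>Markov's inequality divides by \<open>t\<close>, so zero is separate: the integral
  then vanishes and \<open>X\<close> is almost surely nonpositive. For the inner method this occurs
  when the centre is already the minimizer.\<close>
proof (cases "t = 0")
  case True
  then have "AE y in p. ennreal (X y) = 0"
    using int by (subst nn_integral_0_iff_AE[symmetric]) auto
  then have "AE y in p. y \<in> {y. X y \<le> t}"
    by eventually_elim (simp add: True ennreal_eq_0_iff)
  then have "measure_pmf.prob p {y. X y \<le> t} = 1"
    by (subst measure_pmf.prob_eq_1) auto
  then show ?thesis
    using assms by simp
next
  case False
  then have t: "t > 0" using assms by simp
  have "emeasure p {y \<in> UNIV. 1 \<le> ennreal (1 / t) * ennreal (X y)}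
      \<le> ennreal (1 / t) * (\<integral>\<^sup>+y. ennreal (X y) * indicator UNIV y \<partial>p)"
    by (rule order_trans[OF _ nn_integral_Markov_inequality]) auto
  also have "\<dots> \<le> ennreal (1 / t) * ennreal (\<eta> * t)"
    using int by (intro mult_left_mono) auto
  also have "\<dots> = ennreal \<eta>"
    using t assms by (simp flip: ennreal_mult')
  finally have "measure_pmf.prob p {y. 1 \<le> ennreal (1 / t) * ennreal (X y)} \<le> \<eta>"
    using assms by (simp add: measure_pmf.emeasure_eq_measure)
  moreover have "- {y. X y \<le> t} \<subseteq> {y. 1 \<le> ennreal (1 / t) * ennreal (X y)}"
    using t by (auto simp flip: ennreal_mult' simp: field_simps)
  then have "measure_pmf.prob p (- {y. X y \<le> t}) \<le> measure_pmf.prob p {y. 1 \<le> ennreal (1 / t) * ennreal (X y)}"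
    by (intro measure_pmf.finite_measure_mono) auto
  moreover have "measure_pmf.prob p (- {y. X y \<le> t}) = 1 - measure_pmf.prob p {y. X y \<le> t}"
    using measure_pmf.prob_compl[of "{y. X y \<le> t}" p] by (simp add: Compl_eq_Diff_UNIV)
  ultimately show ?thesis
    by linarith
qed

context coord_smooth_convex
begin

lemma coord_descent_inexact_solution:
  assumes N: "exp (- real N * H / Z) * ((1 + L / H) * (3 + 2 * L / H)\<^sup>2) \<le> \<eta>"
  shows "measure_pmf.prob (coord_descent H Lc N (aux c) c)
    {v. norm (grad (aux c) v) \<le> H / 2 * norm (v - c)} \<ge> 1 - \<eta>"
proof -
  obtain ys where min: "\<And>y. aux c ys \<le> aux c y" and crit: "grad (aux c) ys = 0"
    using aux_minimizer[of c] by blast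
  let ?q = "3 + 2 * L / H" and ?e = "exp (- real N * H / Z)"
  let ?t = "H / 2 * (norm (c - ys) / ?q)\<^sup>2"
  have q: "?q > 0"
    using L_nonneg H_pos by (intro add_pos_nonneg) auto
  have \<eta>: "0 \<le> \<eta>"
    using L_nonneg H_pos by (intro order_trans[OF _ N]) simp
  have "?e * (aux c c - aux c ys) \<le> ?e * ((L + H) / 2 * (norm (c - ys))\<^sup>2)"
    by (intro mult_left_mono aux_gap_le_dist crit) simp
  \<comment> \<open>The factor (1 + L / H) (3 + 2 L / H)^2 is the ratio of the bound on the initial
    gap to the target gap \<open>?t\<close>.\<close>
  also have "\<dots> = ?e * ((1 + L / H) * ?q\<^sup>2) * ?t"
    using q H_pos by (simp add: power_divide) (simp add: field_simps)
  also have "\<dots> \<le> \<eta> * ?t"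
    using N H_pos by (intro mult_right_mono) auto
  finally have "(\<integral>\<^sup>+y. ennreal (aux c y - aux c ys) \<partial>coord_descent H Lc N (aux c) c) \<le> ennreal (\<eta> * ?t)"
    by (intro order_trans[OF nn_integral_coord_descent[OF min]] ennreal_leI)
  then have "1 - \<eta> \<le> measure_pmf.prob (coord_descent H Lc N (aux c) c) {y. aux c y - aux c ys \<le> ?t}"
    using H_pos \<eta> by (intro prob_le_of_nn_integral_le) auto
  also have "\<dots> \<le> measure_pmf.prob (coord_descent H Lc N (aux c) c)
      {v. norm (grad (aux c) v) \<le> H / 2 * norm (v - c)}"
    using aux_gap_imp_inexact_solution[OF crit]
    by (intro measure_pmf.finite_measure_mono) auto
  finally show ?thesis .
qed

end

section \<open>Choice of the iteration counts\<close>

theorem theorem3: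
  fixes f :: "real^'n \<Rightarrow> real" and x0 xs :: "real^'n"
    and L H \<delta> \<epsilon> Z :: real and Lc :: "'n \<Rightarrow> real" and N_outer N_inner :: nat
  assumes diff: "\<And>x. f differentiable (at x)"
    and conv: "convex_on UNIV f"
    and minimizer: "\<And>x. f xs \<le> f x"
    and grad_lipschitz: "L-lipschitz_on UNIV (grad f)"
    and coord_lipschitz:
      "\<And>i x u. \<bar>grad f (x + u *\<^sub>R axis i 1) $ i - grad f x $ i\<bar> \<le> Lc i * \<bar>u\<bar>"
    and H: "H > 0"
    and delta: "0 < \<delta>" "\<delta> < 1"
    and eps: "\<epsilon> > 0"
    and Z: "Z = (\<Sum>i\<in>UNIV. H + Lc i)"
    and N_outer: "int N_outer \<ge> \<lceil>4 * sqrt 15 / 5 * sqrt (H * (norm (x0 - xs))\<^sup>2 / \<epsilon>)\<rceil>"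
    and N_inner: "int N_inner \<ge>
      \<lceil>Z / H * ln (real N_outer / \<delta> * (1 + L / H) * (3 + 2 * L / H)\<^sup>2)\<rceil>"
  shows "measure_pmf.prob (accel_meta_output (coord_descent H Lc N_inner) f H x0 N_outer)
           {v. f v - f xs < \<epsilon>} \<ge> 1 - \<delta>"
\<comment> \<open>Without outer iterations the budget \<delta> / N per run makes no sense; here the
  bound on \<open>N_outer\<close> forces \<open>x0 = xs\<close>, and the output is
  \<open>x0\<close>.\<close>
proof (cases "N_outer = 0")
  case True
  then have "sqrt (H * (norm (x0 - xs))\<^sup>2 / \<epsilon>) \<le> 0"
    using N_outer by (simp add: ceiling_le_zero mult_le_0_iff)
  then have "x0 = xs"
    using H eps by (simp add: divide_le_0_iff mult_le_0_iff)
  then show ?thesis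
    using True eps delta by (simp add: accel_meta_output_def)
next
  case False
  interpret coord_smooth_convex f L H xs Lc
    by unfold_locales (fact assms)+
  define q where "q = (1 + L / H) * (3 + 2 * L / H)\<^sup>2"
  define N where "N = real N_outer"
  have N: "N > 0"
    using False by (simp add: N_def)
  have "3 + 2 * L / H > 0" "1 + L / H > 0"
    using L_nonneg H by (auto intro: add_pos_nonneg)
  then have q: "q > 0"
    by (simp add: q_def)
  have Z_pos': "Z > 0"
    using Z_pos by (simp add: Z)
  \<comment> \<open>Exponentiating the bound on \<open>N_inner\<close> gives each of the
    \<open>N\<close> inner runs a failure budget of \<delta> / N.\<close>
  have "Z / H * ln (N / \<delta> * q) \<le> real N_inner"
    using N_inner by (simp add: ceiling_le_iff q_def N_def mult.assoc)
  then have "ln (N / \<delta> * q) \<le> real N_inner * H / Z"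
    using H Z_pos' by (simp add: field_simps)
  then have "exp (ln (N / \<delta> * q)) \<le> exp (real N_inner * H / Z)"
    by simp
  then have "N / \<delta> * q \<le> exp (real N_inner * H / Z)"
    using N delta q by simp
  then have "exp (- real N_inner * H / Z) * q \<le> \<delta> / N"
    using N delta by (simp add: exp_minus field_simps)
  then have inner: "exp (- real N_inner * H / (\<Sum>i\<in>UNIV. H + Lc i)) * ((1 + L / H) * (3 + 2 * L / H)\<^sup>2) \<le> \<delta> / N"
    by (simp add: q_def Z)
  let ?R = "(norm (x0 - xs))\<^sup>2"
  have "4 * sqrt 15 / 5 * sqrt (H * ?R / \<epsilon>) \<le> N"
    using N_outer by (simp add: ceiling_le_iff N_def)
  then have "(4 * sqrt 15 / 5 * sqrt (H * ?R / \<epsilon>))\<^sup>2 \<le> N\<^sup>2"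
    using H eps by (intro power_mono) auto
  \<comment> \<open>The square of 4 sqrt 15 / 5 is 48/5, whereas the potential argument asks only
    for more than 4. Positivity of \<open>N\<^sup>2 * \<epsilon>\<close> keeps the inequality strict
    even if \<open>x0 = xs\<close>.\<close>
  then have "48 / 5 * (H * ?R / \<epsilon>) \<le> N\<^sup>2"
    using H eps by (simp add: power_mult_distrib power_divide)
  then have "48 / 5 * (H * ?R) \<le> N\<^sup>2 * \<epsilon>"
    using eps by (simp add: field_simps)
  moreover have "N\<^sup>2 * \<epsilon> > 0"
    using N eps by simp
  ultimately have "4 * H * ?R < N\<^sup>2 * \<epsilon>"
    by linarith
  then have R: "?R / 2 < N\<^sup>2 / (8 * H) * \<epsilon>"
    using H by (simp add: field_simps)
  let ?G = "{(x, v). meta_A H N_outer * (f v - f xs) + (norm (x - xs))\<^sup>2 / 2 \<le> ?R / 2}"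
  have "?G \<subseteq> snd -` {v. f v - f xs < \<epsilon>}"
  proof (rule subsetI)
    fix s
    assume "s \<in> ?G"
    then obtain x v where s: "s = (x, v)"
      and "meta_A H N_outer * (f v - f xs) + (norm (x - xs))\<^sup>2 / 2 \<le> ?R / 2"
      by auto
    \<comment> \<open>The gap is nonnegative by minimality of \<open>xs\<close>, so its weight may
      be lowered to the growth bound.\<close>
    moreover have "N\<^sup>2 / (8 * H) * (f v - f xs) \<le> meta_A H N_outer * (f v - f xs)"
      using meta_A_ge[OF H] minimizer[of v] by (intro mult_right_mono) (auto simp: N_def)
    ultimately have "N\<^sup>2 / (8 * H) * (f v - f xs) \<le> ?R / 2"
      using zero_le_power2[of "norm (x - xs)"] by linarith
    also note R
    finally have "f v - f xs < \<epsilon>"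
      using N H by (subst (asm) mult_less_cancel_left_pos) auto
    then show "s \<in> snd -` {v. f v - f xs < \<epsilon>}"
      by (simp add: s)
  qed
  then have "measure_pmf.prob (accel_meta (coord_descent H Lc N_inner) f H x0 N_outer) ?G
      \<le> measure_pmf.prob (accel_meta_output (coord_descent H Lc N_inner) f H x0 N_outer) {v. f v - f xs < \<epsilon>}"
    by (simp add: accel_meta_output_def) (intro measure_pmf.finite_measure_mono; simp)
  moreover have "1 - real N_outer * (\<delta> / N)
      \<le> measure_pmf.prob (accel_meta (coord_descent H Lc N_inner) f H x0 N_outer) ?G"
    using N delta by (intro accel_meta_potential coord_descent_inexact_solution[OF inner]) auto
  ultimately show ?thesis
    using False by (simp add: N_def)
qed

end
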